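(* Let $n\ge0$ be an integer, and for $0\le k\le n$ let $$\hat h^n_k(\theta)=\int_{-1}^1 h^n_k(t)e^{-\mathrm{i}\theta t}\,dt,\qquad\theta\in\mathbb{R},\ \mathrm{i}=\sqrt{-1},$$ where $h^n_k$ is as defined in the context. For integers $N\ge-1$ and odd $J$ with $-1\le J\le N$, put $$F_{N,J}(\theta)=\frac{(-1)^{\frac{J+1}{2}}2^{J+1}\left(\frac{J+1}{2}\right)!\,(N+1)!\,(N+2)!}{(J+2)!\,(2N+3)!\,\left(N+\frac32-\frac J2\right)!}\sqrt{2N-2J+1}\;(-\mathrm{i}\theta)^{N+2}\;{}_2F_3\!\left({\frac{N+3}{2},\ \frac{N+4}{2}\atop \frac{J+4}{2},\ N+\frac52,\ N+\frac{5-J}{2}};\,-\frac{\theta^2}{4}\right).$$ Then for $0\le j\le n$: if $j$ is odd, $\hat h^n_{n-j}(\theta)=F_{n,j}(\theta)$; and if $j$ is even, $\hat h^n_{n-j}(\theta)=F_{n-1,j-1}(\theta)$ (so that $\hat h^n_{n-j}=\hat h^{n-1}_{n-j}$ for $j$ even, $j\ge2$).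
   Context: Notation: $(a)_0=1$, $(a)_m=a(a+1)\cdots(a+m-1)$ for $m>0$; empty products equal $1$; ${}_2F_3\left({a_1,a_2\atop b_1,b_2,b_3};t\right)=\sum_{m\ge0}\frac{(a_1)_m(a_2)_m}{(b_1)_m(b_2)_m(b_3)_m\,m!}t^m$. Definition of $h^n_j$: for an integer $n\ge0$, $0\le k\le n$, and $0\le i\le n$ with $i=0$ or $i$ odd, let $$d^i_{n,k}=(-1)^n\frac{\sqrt{2n-2i+1}}{(-n)_i}\frac{(-n)_k(n-i+1)_k}{(1)_k(1)_k}\prod_{m=0}^{\frac{i-1}{2}}(n+k+1-2m)\prod_{m=0}^{\frac{i-3}{2}}(n-k-1-2m).$$ For $0\le t<1$ let $h_{n-i}^n(t)=\sum_{k=0}^n d^i_{n,k}t^k$ if $i=0$ or $i$ is odd, and $h_{n-i}^n(t)=\sum_{k=0}^{n-1} d^{i-1}_{n-1,k}t^k$ if $i>0$ is even ($0\le i\le n$). Extend to $[-1,0)$ by $h^n_i(-t)=(-1)^{i+1}h^n_i(t)$ for $t\in(0,1)$ (and by continuity at $t=-1$). *)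

theory Defs
  imports "HOL-Analysis.Analysis"
begin

text \<open>
  \<open>d_coeff n i k\<close> is $d^i_{n,k}$, used for $i = 0$ or $i$ odd. The products run over
  $0 \le m \le (i-1)/2$ and $0 \le m \le (i-3)/2$, that is, they have $(i+1)/2$ and $(i-1)/2$
  factors for odd $i$ and are empty for $i = 0$ (natural subtraction and division round the latter
  case to $0$).
\<close>

definition d_coeff :: "nat \<Rightarrow> nat \<Rightarrow> nat \<Rightarrow> real" where
  "d_coeff n i k =
     (-1) ^ n * (sqrt (2 * real n - 2 * real i + 1) / pochhammer (- real n) i)
     * (pochhammer (- real n) k * pochhammer (real n - real i + 1) k
         / (pochhammer 1 k * pochhammer 1 k))
     * (\<Prod>m<(i + 1) div 2. real n + real k + 1 - 2 * real m)
     * (\<Prod>m<(i - 1) div 2. real n - real k - 1 - 2 * real m)"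

text \<open>The polynomial that agrees with $h^n_{n-i}$ on $[0,1)$, for $0 \le i \le n$.\<close>

definition h_poly :: "nat \<Rightarrow> nat \<Rightarrow> real \<Rightarrow> real" where
  "h_poly n i t =
     (if i = 0 \<or> odd i then (\<Sum>k\<le>n. d_coeff n i k * t ^ k)
      else (\<Sum>k\<le>n - 1. d_coeff (n - 1) (i - 1) k * t ^ k))"

text \<open>
  \<open>h n j\<close> is $h^n_j$ on $[-1,1)$, for $0 \le j \le n$. At $t = -1$ the formula below is the
  continuous extension from $(-1,0)$; outside $[-1,1)$ the value is a dummy.
\<close>

definition h :: "nat \<Rightarrow> nat \<Rightarrow> real \<Rightarrow> real" where
  "h n j t =
     (if 0 \<le> t \<and> t < 1 then h_poly n (n - j) t
      else if -1 \<le> t \<and> t < 0 then (-1) ^ (j + 1) * h_poly n (n - j) (- t)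
      else 0)"

definition h_hat :: "nat \<Rightarrow> nat \<Rightarrow> real \<Rightarrow> complex" where
  "h_hat n k \<theta> =
     integral {-1..1} (\<lambda>t. of_real (h n k t) * exp (- \<i> * of_real \<theta> * of_real t))"

definition hyp2F3 :: "real \<Rightarrow> real \<Rightarrow> real \<Rightarrow> real \<Rightarrow> real \<Rightarrow> real \<Rightarrow> real" where
  "hyp2F3 a1 a2 b1 b2 b3 t = eval_fps (fps_hypergeo [a1, a2] [b1, b2, b3] 1) t"

lemma hyp2F3_series:
  "hyp2F3 a1 a2 b1 b2 b3 t =
     (\<Sum>m. pochhammer a1 m * pochhammer a2 m
          / (pochhammer b1 m * pochhammer b2 m * pochhammer b3 m * fact m) * t ^ m)"
  by (simp add: hyp2F3_def eval_fps_def fps_hypergeo_nth)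

text \<open>
  Intended for $N \ge -1$ and odd $J$ with $-1 \le J \le N$; then the arguments of
  \<^const>\<open>nat\<close> are nonnegative and the integer divisions by 2 are exact, so
  $N + (3 - J)/2$ is the integer $N + \frac32 - \frac J2$.
\<close>

definition F :: "int \<Rightarrow> int \<Rightarrow> real \<Rightarrow> complex" where
  "F N J \<theta> =
     of_real
       ((-1) ^ nat ((J + 1) div 2) * 2 ^ nat (J + 1)
          * fact (nat ((J + 1) div 2)) * fact (nat (N + 1)) * fact (nat (N + 2))
        / (fact (nat (J + 2)) * fact (nat (2 * N + 3)) * fact (nat (N + (3 - J) div 2)))
        * sqrt (2 * real_of_int N - 2 * real_of_int J + 1))
     * (- \<i> * of_real \<theta>) ^ nat (N + 2)
     * of_real
         (hyp2F3 ((real_of_int N + 3) / 2) ((real_of_int N + 4) / 2)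
            ((real_of_int J + 4) / 2) (real_of_int N + 5 / 2)
            (real_of_int N + (5 - real_of_int J) / 2)
            (- (\<theta>\<^sup>2 / 4)))"

end

theory Submission
  imports Defs "HOL-Computational_Algebra.Polynomial"
begin

text \<open>
  Expand \<open>e ^ (-\<i>\<theta>t)\<close> into its power series. The reflection rule makes \<open>h\<close> even or odd, so half of the powers
  cancel, and the Fourier transform becomes \<open>\<Sum>\<^sub>p 2 (-\<i>\<theta>) ^ p / p!\<close> times the moment
  \<open>\<Sum>\<^sub>k d\<^sub>k / (k + p + 1)\<close>, the sum being over the remaining \<open>p\<close> (\<open>h_hat_sums_moments\<close>).

  The moments have a closed form. The coefficients are \<open>(-1) ^ k\<close> times a binomial coefficient times \<open>P(k)\<close>
  for a polynomial \<open>P\<close> of degree at most \<open>n\<close>, given as a product of linear factors, and for such sums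
  \<open>\<Sum>\<^sub>k (-1) ^ k (n choose k) P(k) / (k + x) = P(-x) n! / (x)\<^sub>n\<^sub>+\<^sub>1\<close>: this is the partial fraction
  decomposition, and it holds because \<open>n\<close>-th differences of polynomials of lower degree vanish
  (\<open>partial_fraction_sum\<close>). At \<open>x = p + 1\<close> the linear factors of \<open>P\<close> annihilate the moments for every
  \<open>p \<le> n\<close> of the relevant parity (\<open>d_coeff_moment_eq_0\<close>). The moments that remain are quotients of factorials
  (\<open>d_coeff_moment_odd\<close>, \<open>d_coeff_moment_0\<close>), and the ratio of consecutive terms identifies their generating
  series as the stated \<open>2F3\<close> series (\<open>hat_coeff_hypergeometric\<close>, \<open>F_eq_of_sums\<close>).

  For even \<open>j \<ge> 2\<close> the function \<open>h\<close> with indices \<open>n\<close> and \<open>n - j\<close> coincides with the one with indices \<open>n - 1\<close>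
  and \<open>n - j\<close>, which is a case with odd index. Only \<open>j = 0\<close> needs its own evaluation of the moments.
\<close>

section \<open>Alternating binomial sums of polynomials\<close>

text \<open>
  The sum is, up to sign, the \<open>n\<close>-th finite difference of \<open>R\<close> at \<open>0\<close>. Writing \<open>R = a + x Q\<close> and absorbing
  the factor \<open>k\<close> into the binomial coefficient turns it into an \<open>(n - 1)\<close>-st difference of the shifted
  polynomial \<open>Q(x + 1)\<close>, whose degree is one less than that of \<open>R\<close> unless \<open>R\<close> is constant, when \<open>Q = 0\<close>.
\<close>

lemma finite_difference_eq_0:
  fixes R :: "real poly"
  assumes "degree R < n"
  shows "(\<Sum>k\<le>n. (-1) ^ k * of_nat (n choose k) * poly R (of_nat k)) = 0"
  using assms
proof (induction n arbitrary: R)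
  case (Suc m)
  obtain a Q where R: "R = pCons a Q"
    by (cases R)
  define Q' where "Q' = pcompose Q [:1, 1:]"
  have Q': "(\<Sum>k\<le>m. (-1) ^ k * of_nat (m choose k) * poly Q' (of_nat k)) = 0"
  proof (cases "Q = 0")
    case False
    then have "degree Q' < m"
      using Suc.prems by (simp add: R Q'_def degree_pcompose)
    then show ?thesis
      by (rule Suc.IH)
  qed (simp add: Q'_def)
  have "(\<Sum>k\<le>Suc m. (-1) ^ k * of_nat (Suc m choose k) * poly R (of_nat k))
      = a * (\<Sum>k\<le>Suc m. (-1) ^ k * of_nat (Suc m choose k))
        + (\<Sum>k\<le>Suc m. (-1) ^ k * (of_nat k * of_nat (Suc m choose k)) * poly Q (of_nat k))"
    unfolding sum_distrib_left sum.distrib [symmetric]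
    by (intro sum.cong) (auto simp: R algebra_simps)
  also have "(\<Sum>k\<le>Suc m. (-1) ^ k * real (Suc m choose k)) = 0"
    using choose_alternating_sum [of "Suc m", where ?'a = real] by simp
  also have "(\<Sum>k\<le>Suc m. (-1) ^ k * (of_nat k * of_nat (Suc m choose k)) * poly Q (of_nat k))
      = (\<Sum>k\<le>m. (-1) ^ Suc k * (real (Suc k) * of_nat (Suc m choose Suc k)) * poly Q (of_nat (Suc k)))"
    by (subst sum.atMost_Suc_shift) simp
  also have "\<dots> = (\<Sum>k\<le>m. - real (Suc m) * ((-1) ^ k * of_nat (m choose k) * poly Q' (of_nat k)))"
    unfolding of_nat_mult [symmetric] Suc_times_binomial
    by (intro sum.cong) (simp_all add: Q'_def poly_pcompose algebra_simps)
  also have "\<dots> = 0"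
    using Q' by (simp only: sum_distrib_left [symmetric])
  finally show ?case by simp
qed simp

text \<open>
  Pascal's rule expresses the sum for \<open>n + 1\<close> at \<open>x\<close> as the difference of the sums for \<open>n\<close> at \<open>x\<close> and
  at \<open>x + 1\<close>.
\<close>

lemma alternating_binomial_reciprocal_sum:
  fixes x :: real
  assumes "x > 0"
  shows "(\<Sum>k\<le>n. (-1) ^ k * of_nat (n choose k) / (of_nat k + x)) = fact n / pochhammer x (Suc n)"
  using assms
proof (induction n arbitrary: x)
  case (Suc n)
  have "(\<Sum>k\<le>Suc n. (-1) ^ k * of_nat (Suc n choose k) / (of_nat k + x))
      = 1 / x + (\<Sum>k\<le>n. (-1) ^ Suc k * (real (n choose k) + real (n choose Suc k)) / (of_nat (Suc k) + x))"
    by (subst sum.atMost_Suc_shift) simp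
  also have "\<dots> = (1 / x + (\<Sum>k\<le>n. (-1) ^ Suc k * of_nat (n choose Suc k) / (of_nat (Suc k) + x)))
      - (\<Sum>k\<le>n. (-1) ^ k * of_nat (n choose k) / (of_nat k + (x + 1)))"
    unfolding add_diff_eq [symmetric] sum_subtractf [symmetric]
    by (intro arg_cong2 [of _ _ _ _ "(+)"] sum.cong)
       (simp_all add: add_divide_distrib diff_divide_distrib algebra_simps)
  also have "1 / x + (\<Sum>k\<le>n. (-1) ^ Suc k * of_nat (n choose Suc k) / (of_nat (Suc k) + x))
      = (\<Sum>k\<le>Suc n. (-1) ^ k * of_nat (n choose k) / (of_nat k + x))"
    by (subst sum.atMost_Suc_shift) simp
  also have "\<dots> = fact n / pochhammer x (Suc n)"
    using Suc by simp
  also have "(\<Sum>k\<le>n. (-1) ^ k * of_nat (n choose k) / (of_nat k + (x + 1)))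
      = fact n / pochhammer (x + 1) (Suc n)"
    using Suc by simp
  also have "fact n / pochhammer x (Suc n) - fact n / pochhammer (x + 1) (Suc n)
      = fact (Suc n) / pochhammer x (Suc (Suc n))"
  proof -
    define w where "w = pochhammer (x + 1) n"
    have "w > 0"
      using Suc.prems by (simp add: w_def pochhammer_pos)
    moreover have "pochhammer x (Suc n) = x * w"
      by (simp add: w_def pochhammer_rec)
    moreover have "pochhammer (x + 1) (Suc n) = (x + 1 + n) * w"
      by (simp add: w_def pochhammer_rec')
    moreover have "pochhammer x (Suc (Suc n)) = x * (x + 1 + n) * w"
      by (simp add: w_def pochhammer_rec [of x "Suc n"] pochhammer_rec' [of "x + 1" n])
    ultimately show ?thesis
      using Suc.prems by (simp add: divide_simps) (simp add: algebra_simps)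
  qed
  finally show ?case .
qed simp

lemma pochhammer_neg_nat:
  "pochhammer (- real n) k / fact k = (-1) ^ k * real (n choose k)"
proof -
  have "real (n choose k) = (-1) ^ k * pochhammer (- real n) k / fact k"
    by (simp add: binomial_gbinomial gbinomial_pochhammer)
  then show ?thesis by simp
qed

text \<open>
  Divide with remainder: \<open>P(k) = P(-x) + (k + x) R(k)\<close>. The quotient \<open>R\<close> has degree below \<open>n\<close>, so its
  alternating binomial sum is zero, and only the constant \<open>P(-x)\<close> contributes. The lemma thus evaluates
  the sum by substituting \<open>-x\<close> for the summation index in \<open>P\<close>.
\<close>

lemma partial_fraction_sum:
  fixes P :: "real poly" and x :: real
  assumes "degree P \<le> n" "x > 0"
  shows "(\<Sum>k\<le>n. pochhammer (- real n) k / fact k * poly P (of_nat k) / (of_nat k + x))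
       = poly P (- x) * fact n / pochhammer x (Suc n)"
proof -
  define R where "R = synthetic_div P (- x)"
  have P: "poly P y = poly P (- x) + (y + x) * poly R y" for y
    using arg_cong [OF synthetic_div_correct [of P "- x"], of "\<lambda>p. poly p y"]
    by (simp add: R_def algebra_simps)
  have R: "(\<Sum>k\<le>n. (-1) ^ k * of_nat (n choose k) * poly R (of_nat k)) = 0"
  proof (cases "degree P = 0")
    case True
    then have "R = 0"
      by (simp add: R_def synthetic_div_eq_0_iff)
    then show ?thesis by simp
  next
    case False
    then have "degree R < n"
      using assms by (simp add: R_def degree_synthetic_div)
    then show ?thesis
      by (rule finite_difference_eq_0)
  qed
  have "(\<Sum>k\<le>n. pochhammer (- real n) k / fact k * poly P (of_nat k) / (of_nat k + x))
      = poly P (- x) * (\<Sum>k\<le>n. (-1) ^ k * of_nat (n choose k) / (of_nat k + x))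
        + (\<Sum>k\<le>n. (-1) ^ k * of_nat (n choose k) * poly R (of_nat k))"
    unfolding sum_distrib_left sum.distrib [symmetric] pochhammer_neg_nat
  proof (intro sum.cong refl)
    fix k
    have "real k + x \<noteq> 0"
      using assms by (simp add: add_nonneg_eq_0_iff)
    then show "(-1) ^ k * real (n choose k) * poly P (real k) / (real k + x) =
         poly P (- x) * ((-1) ^ k * real (n choose k) / (real k + x)) +
         (-1) ^ k * real (n choose k) * poly R (real k)"
      by (subst P [of "real k"]) (simp add: field_simps)
  qed
  then show ?thesis
    using R alternating_binomial_reciprocal_sum [OF assms(2), of n] by simp
qed

section \<open>Moments of the polynomials\<close>

text \<open>
  The left-hand side is the integral of \<open>t ^ p\<close> times the polynomial with coefficients \<^term>\<open>d_coeff n i\<close> over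
  the unit interval. Since \<open>(n - i + 1)\<^sub>k / k! = (k + 1)\<^sub>n\<^sub>-\<^sub>i / (n - i)!\<close> is a polynomial in \<open>k\<close> of degree \<open>n - i\<close>,
  the coefficient is \<open>(-n)\<^sub>k / k!\<close> times a polynomial in \<open>k\<close> of degree at most \<open>n\<close>, and the moment is a
  multiple of the value of that polynomial at \<open>-p - 1\<close>. All factors are kept explicit because their
  zeros decide which moments vanish.
\<close>

lemma d_coeff_moment:
  assumes "i \<le> n"
  shows "(\<Sum>k\<le>n. d_coeff n i k / (real k + real p + 1))
     = (-1) ^ n * (sqrt (2 * real n - 2 * real i + 1) / pochhammer (- real n) i)
       * (pochhammer (- real p) (n - i) / fact (n - i)
          * (\<Prod>m<(i + 1) div 2. real n - real p - 2 * real m)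
          * (\<Prod>m<(i - 1) div 2. real n + real p - 2 * real m))
       * (fact n * fact p / fact (n + p + 1))"
proof -
  \<comment> \<open>\<open>A\<close>, \<open>B\<close>, \<open>C\<close> carry the rising factorial and the two products of the coefficient as polynomials in \<open>k\<close>.\<close>
  define A where "A = (\<Prod>m<n - i. [:1 + real m, 1:])"
  define B where "B = (\<Prod>m<(i + 1) div 2. [:real n + 1 - 2 * real m, 1:])"
  define C where "C = (\<Prod>m<(i - 1) div 2. [:real n - 1 - 2 * real m, -1:])"
  define P where "P = smult (1 / fact (n - i)) (A * B * C)"
  have "degree A \<le> n - i" "degree B \<le> (i + 1) div 2" "degree C \<le> (i - 1) div 2"
    unfolding A_def B_def C_def by (rule order.trans [OF degree_prod_sum_le], simp_all add: o_def)+
  then have "degree (A * B * C) \<le> (n - i) + (i + 1) div 2 + (i - 1) div 2"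
    by (meson add_mono degree_mult_le order.trans)
  also have "\<dots> \<le> n"
    using assms by linarith
  finally have deg: "degree P \<le> n"
    by (simp add: P_def)
  have P: "poly P y = pochhammer (y + 1) (n - i) / fact (n - i)
      * (\<Prod>m<(i + 1) div 2. real n + y + 1 - 2 * real m)
      * (\<Prod>m<(i - 1) div 2. real n - y - 1 - 2 * real m)" for y
    by (simp add: P_def A_def B_def C_def poly_prod pochhammer_prod algebra_simps atLeast0LessThan)
  \<comment> \<open>Both sides, multiplied by \<open>k! (n - i)!\<close>, are \<open>(n - i + k)!\<close>.\<close>
  have rising: "pochhammer (real n - real i + 1) k / fact k = pochhammer (real k + 1) (n - i) / fact (n - i)" for k
  proof -
    have "fact (n - i) * pochhammer (real n - real i + 1) k = (fact (n - i + k) :: real)"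
      using pochhammer_product' [of "1::real" "n - i" k] assms
      by (simp add: pochhammer_fact of_nat_diff add_ac)
    moreover have "fact k * pochhammer (real k + 1) (n - i) = (fact (n - i + k) :: real)"
      using pochhammer_product' [of "1::real" k "n - i"]
      by (simp add: pochhammer_fact add_ac)
    ultimately have "fact (n - i) * pochhammer (real n - real i + 1) k
       = fact k * pochhammer (real k + 1) (n - i)" by simp
    then show ?thesis by (simp add: divide_simps mult_ac)
  qed
  have fact_p: "pochhammer (real p + 1) (Suc n) = fact (n + p + 1) / fact p"
    using pochhammer_product' [of "1::real" p "Suc n"]
    by (simp add: pochhammer_fact [symmetric] add_ac)
  define K where "K = (-1) ^ n * (sqrt (2 * real n - 2 * real i + 1) / pochhammer (- real n) i)"
  have "d_coeff n i k = K * (pochhammer (- real n) k / fact k * poly P (real k))" for k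
    unfolding d_coeff_def K_def [symmetric] P rising [symmetric]
    by (simp add: pochhammer_fact [symmetric] mult_ac)
  then have "(\<Sum>k\<le>n. d_coeff n i k / (real k + real p + 1))
     = K * (\<Sum>k\<le>n. pochhammer (- real n) k / fact k * poly P (real k) / (real k + (real p + 1)))"
    by (simp add: sum_distrib_left mult_ac add_ac)
  also have "\<dots> = K * (poly P (- (real p + 1)) * fact n / pochhammer (real p + 1) (Suc n))"
    by (subst partial_fraction_sum [OF deg]) simp_all
  also have "poly P (- (real p + 1)) = pochhammer (- real p) (n - i) / fact (n - i)
          * (\<Prod>m<(i + 1) div 2. real n - real p - 2 * real m)
          * (\<Prod>m<(i - 1) div 2. real n + real p - 2 * real m)"
    by (simp add: P algebra_simps)
  finally show ?thesis
    by (simp only: fact_p K_def [symmetric]) (simp add: mult_ac)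
qed

section \<open>Moment expansion of the Fourier transform\<close>

text \<open>
  The exponential series converges uniformly on the unit interval even after multiplication by a
  polynomial, so it may be integrated term by term; the coefficient of \<open>z ^ p / p!\<close> is the \<open>p\<close>-th moment.
\<close>

lemma poly_times_exp_integral:
  fixes c :: "nat \<Rightarrow> real" and z :: complex
  obtains I where
    "((\<lambda>t. of_real (\<Sum>k\<le>n. c k * t ^ k) * exp (z * of_real t)) has_integral I) {0..1}"
    "(\<lambda>p. z ^ p / fact p * of_real (\<Sum>k\<le>n. c k / (real k + real p + 1))) sums I"
proof -
  define q where "q t = (\<Sum>k\<le>n. c k * t ^ k)" for t
  define f where "f p t = complex_of_real (q t) * ((z * of_real t) ^ p /\<^sub>R fact p)" for p t
  define M where "M p = (\<Sum>k\<le>n. \<bar>c k\<bar>) * (norm z ^ p /\<^sub>R fact p)" for p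
  have f_bound: "norm (f p t) \<le> M p" if "t \<in> {0..1}" for p t
  proof -
    have "\<bar>q t\<bar> \<le> (\<Sum>k\<le>n. \<bar>c k\<bar>)"
      unfolding q_def using that
      by (intro order.trans [OF sum_abs] sum_mono)
         (auto simp: abs_mult power_le_one mult_left_le)
    moreover have "norm ((z * complex_of_real t) ^ p) \<le> norm z ^ p"
      using that by (simp add: norm_power norm_mult power_mult_distrib power_le_one mult_left_le)
    ultimately show ?thesis
      unfolding f_def M_def norm_mult norm_scaleR
      by (intro mult_mono) (auto intro!: mult_left_mono simp: norm_of_real)
  qed
  have "summable M"
    unfolding M_def by (intro summable_mult summable_exp_generic)
  then have "uniform_limit {0..1} (\<lambda>N t. \<Sum>p<N. f p t) (\<lambda>t. \<Sum>p. f p t) sequentially"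
    using f_bound by (intro Weierstrass_m_test)
  moreover have "(\<lambda>t. \<Sum>p. f p t) = (\<lambda>t. of_real (q t) * exp (z * of_real t))"
    unfolding f_def exp_def by (intro ext suminf_mult summable_exp_generic)
  ultimately have lim: "uniform_limit {0..1} (\<lambda>N t. \<Sum>p<N. f p t)
      (\<lambda>t. of_real (q t) * exp (z * of_real t)) sequentially"
    by simp
  have cont: "continuous_on {0..1} (\<lambda>t. \<Sum>p<N. f p t)" for N
    unfolding f_def q_def by (intro continuous_intros)
  obtain S I where S: "\<And>N. ((\<lambda>t. \<Sum>p<N. f p t) has_integral S N) {0..1}"
    and I: "((\<lambda>t. of_real (q t) * exp (z * of_real t)) has_integral I) {0..1}"
    and SI: "S \<longlonglongrightarrow> I"
    using uniform_limit_integral [OF lim cont] by auto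
  have f_int: "(f p has_integral z ^ p / fact p * of_real (\<Sum>k\<le>n. c k / (real k + real p + 1))) {0..1}" for p
  proof -
    have monomial: "((\<lambda>t::real. t ^ m) has_integral 1 / (real m + 1)) {0..1}" for m
    proof -
      have "((\<lambda>t. t ^ m) has_integral (1 ^ Suc m / real (Suc m) - 0 ^ Suc m / real (Suc m))) {0..1}"
      proof (rule fundamental_theorem_of_calculus)
        show "((\<lambda>t. t ^ Suc m / real (Suc m)) has_vector_derivative t ^ m) (at t within {0..1})" for t :: real
          using DERIV_cdivide [OF DERIV_pow [of "Suc m" t "{0..1}"], of "real (Suc m)"]
          by (simp add: has_real_derivative_iff_has_vector_derivative [symmetric] del: of_nat_Suc)
      qed simp
      then show ?thesis by (simp add: add_ac)
    qed
    have "((\<lambda>t. \<Sum>k\<le>n. c k * t ^ (k + p)) has_integral (\<Sum>k\<le>n. c k * (1 / (real (k + p) + 1)))) {0..1}"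
      by (intro has_integral_sum has_integral_mult_right monomial) auto
    then have "((\<lambda>t. complex_of_real (\<Sum>k\<le>n. c k * t ^ (k + p))) has_integral
        of_real (\<Sum>k\<le>n. c k * (1 / (real (k + p) + 1)))) {0..1}"
      by (rule has_integral_of_real)
    then have "((\<lambda>t. z ^ p / fact p * complex_of_real (\<Sum>k\<le>n. c k * t ^ (k + p))) has_integral
        z ^ p / fact p * of_real (\<Sum>k\<le>n. c k * (1 / (real (k + p) + 1)))) {0..1}"
      by (rule has_integral_mult_right)
    moreover have "z ^ p / fact p * complex_of_real (\<Sum>k\<le>n. c k * t ^ (k + p)) = f p t" for t
    proof -
      have "(\<Sum>k\<le>n. c k * t ^ (k + p)) = q t * t ^ p"
        by (simp add: q_def sum_distrib_right power_add mult.assoc)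
      then show ?thesis
        by (simp add: f_def power_mult_distrib scaleR_conv_of_real field_simps)
    qed
    ultimately show ?thesis by (simp add: add_ac)
  qed
  have "S N = (\<Sum>p<N. z ^ p / fact p * of_real (\<Sum>k\<le>n. c k / (real k + real p + 1)))" for N
    by (rule has_integral_unique [OF S]) (intro has_integral_sum f_int finite_lessThan)
  then have "(\<lambda>p. z ^ p / fact p * of_real (\<Sum>k\<le>n. c k / (real k + real p + 1))) sums I"
    using SI unfolding sums_def by presburger
  with I show ?thesis
    by (intro that) (simp_all add: q_def)
qed

text \<open>
  The reflection rule for \<^term>\<open>h n (n - j)\<close> turns the integral over \<open>[-1,0]\<close> into \<open>(-1) ^ (n - j + 1)\<close> times the
  integral over \<open>[0,1]\<close> with the sign of \<open>\<theta>\<close> reversed. Adding the two power series kills every power whose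
  parity differs from that of \<open>n - j + 1\<close> and doubles the others.
\<close>

lemma h_hat_sums_moments:
  fixes c :: "nat \<Rightarrow> real"
  assumes "j \<le> n" and q: "\<And>t. h_poly n j t = (\<Sum>k\<le>m. c k * t ^ k)"
  shows "(\<lambda>p. (1 + (-1) ^ (n - j + 1 + p)) * (- \<i> * of_real \<theta>) ^ p / fact p
            * of_real (\<Sum>k\<le>m. c k / (real k + real p + 1))) sums h_hat n (n - j) \<theta>"
proof -
  define z where "z = - \<i> * complex_of_real \<theta>"
  define \<epsilon> :: complex where "\<epsilon> = (-1) ^ (n - j + 1)"
  obtain I where I: "((\<lambda>t. of_real (\<Sum>k\<le>m. c k * t ^ k) * exp (z * of_real t)) has_integral I) {0..1}"
    and I_sums: "(\<lambda>p. z ^ p / fact p * of_real (\<Sum>k\<le>m. c k / (real k + real p + 1))) sums I"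
    by (rule poly_times_exp_integral)
  obtain J where J: "((\<lambda>t. of_real (\<Sum>k\<le>m. c k * t ^ k) * exp (- z * of_real t)) has_integral J) {0..1}"
    and J_sums: "(\<lambda>p. (- z) ^ p / fact p * of_real (\<Sum>k\<le>m. c k / (real k + real p + 1))) sums J"
    by (rule poly_times_exp_integral)
  let ?f = "\<lambda>t. of_real (h n (n - j) t) * exp (- \<i> * of_real \<theta> * of_real t)"
  \<comment> \<open>The value at \<open>t = 1\<close> is a dummy, and \<open>t = 0\<close> belongs to the right half; single points do not affect integrals.\<close>
  have right: "(?f has_integral I) {0..1}"
    by (rule has_integral_spike_finite [OF _ _ I, of "{1}"])
       (use assms in \<open>auto simp: h_def z_def\<close>)
  have "((\<lambda>t. \<epsilon> * (of_real (\<Sum>k\<le>m. c k * (- t) ^ k) * exp (- z * of_real (- t)))) has_integral \<epsilon> * J) {-1..0}"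
    using has_integral_mult_right [OF has_integral_reflect_lemma_real [OF J], of \<epsilon>] by (simp only: minus_zero)
  then have left: "(?f has_integral \<epsilon> * J) {-1..0}"
    by (rule has_integral_spike_finite [of "{0}", rotated 2])
       (use assms in \<open>auto simp: h_def z_def \<epsilon>_def\<close>)
  have "h_hat n (n - j) \<theta> = \<epsilon> * J + I"
    unfolding h_hat_def
    by (rule integral_unique) (rule has_integral_combine [OF _ _ left right], simp_all)
  moreover have "(\<lambda>p. \<epsilon> * ((- z) ^ p / fact p * of_real (\<Sum>k\<le>m. c k / (real k + real p + 1)))
      + z ^ p / fact p * of_real (\<Sum>k\<le>m. c k / (real k + real p + 1))) sums (\<epsilon> * J + I)"
    by (intro sums_add sums_mult I_sums J_sums)
  moreover have "\<epsilon> * ((- z) ^ p / fact p * w) + z ^ p / fact p * w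
      = (1 + (-1) ^ (n - j + 1 + p)) * z ^ p / fact p * w" for p w
    unfolding power_minus [of z] \<epsilon>_def power_add [of _ "n - j + 1"] by (simp add: field_simps)
  ultimately show ?thesis
    by (simp only: z_def)
qed

section \<open>The hypergeometric series\<close>

text \<open>
  Up to the square root, these are the coefficients of the transform at \<open>(-\<i>\<theta>) ^ (a + 1 + 2s)\<close>, with \<open>a = N + 1\<close>
  and \<open>L = (J + 1) / 2\<close>. In this natural-number parametrization \<open>J = -1\<close> is simply \<open>L = 0\<close>.
\<close>

definition hat_coeff :: "nat \<Rightarrow> nat \<Rightarrow> nat \<Rightarrow> real" where
  "hat_coeff a L s =
     (-4) ^ L * fact (a + 1 + 2 * s) * fact (s + L) * fact (a + s)
     / (fact s * fact (a + 1 + s - L) * fact (2 * s + 2 * L + 1) * fact (2 * a + 1 + 2 * s))"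

text \<open>
  Passing from \<open>s\<close> to \<open>s + 1\<close> multiplies the coefficient by a rational function of \<open>s\<close>. In it, \<open>s + L + 1\<close> and
  \<open>a + s + 1\<close> cancel against even factors of \<open>(2s + 2L + 3)!\<close> and \<open>(2a + 2s + 3)!\<close>; what is left is the
  term ratio of a \<open>2F3\<close> series at argument \<open>1 / 4\<close>.
\<close>

lemma hat_coeff_hypergeometric:
  assumes "L \<le> a"
  shows "hat_coeff a L s = hat_coeff a L 0
     * (pochhammer ((real a + 2) / 2) s * pochhammer ((real a + 3) / 2) s
        / (pochhammer (real L + 3 / 2) s * pochhammer (real a + 3 / 2) s
           * pochhammer (real a + 2 - real L) s * fact s) * (1 / 4) ^ s)"
proof (induction s)
  case (Suc s)
  define r where "r = (real a + 2 * s + 2) * (real a + 2 * s + 3)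
     / ((2 * s + 2 * L + 3) * (2 * real a + 2 * s + 3) * (real a + 2 - real L + s) * (real s + 1))"
  have pos: "real a + 2 - real L + s > 0"
    using assms by linarith
  have 1: "fact (a + 1 + 2 * Suc s) = (real a + 2 * s + 2) * (real a + 2 * s + 3) * fact (a + 1 + 2 * s)"
    by (simp add: algebra_simps)
  have 2: "fact (Suc s + L) = (real s + L + 1) * fact (s + L)"
    "fact (a + Suc s) = (real a + s + 1) * fact (a + s)"
    "fact (Suc s) = (real s + 1) * fact s"
    by (simp_all add: algebra_simps)
  have 3: "fact (a + 1 + Suc s - L) = (real a + 2 - real L + s) * fact (a + 1 + s - L)"
    using assms by (simp add: Suc_diff_le of_nat_diff algebra_simps)
  have 4: "fact (2 * Suc s + 2 * L + 1) = 2 * (real s + L + 1) * (2 * s + 2 * L + 3) * fact (2 * s + 2 * L + 1)"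
    "fact (2 * a + 1 + 2 * Suc s) = 2 * (real a + s + 1) * (2 * real a + 2 * s + 3) * fact (2 * a + 1 + 2 * s)"
    by (simp_all add: algebra_simps)
  have nz: "real s + L + 1 \<noteq> 0" "real a + s + 1 \<noteq> 0"
    by linarith+
  have "hat_coeff a L (Suc s) = hat_coeff a L s * (r / 4)"
    unfolding hat_coeff_def 1 2 3 4 r_def
    using nz pos by (simp add: divide_simps) (simp add: algebra_simps)
  also have "\<dots> = hat_coeff a L 0
     * (pochhammer ((real a + 2) / 2) s * pochhammer ((real a + 3) / 2) s
        / (pochhammer (real L + 3 / 2) s * pochhammer (real a + 3 / 2) s
           * pochhammer (real a + 2 - real L) s * fact s) * (1 / 4) ^ s) * (r / 4)"
    by (subst Suc.IH) simp
  also have "r = ((real a + 2) / 2 + s) * ((real a + 3) / 2 + s)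
      / ((real L + 3 / 2 + s) * (real a + 3 / 2 + s) * (real a + 2 - real L + s) * (real s + 1))"
    using pos by (simp add: r_def divide_simps) (simp add: algebra_simps)
  finally show ?case
    by (simp add: pochhammer_rec' mult_ac)
qed simp

text \<open>
  Recognizes \<^const>\<open>F\<close> from its power series. The summability of the hypergeometric series is inherited from
  the assumed convergence after division by the prefactor, which is nonzero for \<open>\<theta> \<noteq> 0\<close>
  because \<open>2 L \<le> a\<close> keeps the square root positive; for \<open>\<theta> = 0\<close> both
  sides vanish because of the factor \<open>\<theta> ^ (a + 1)\<close>.
\<close>

lemma F_eq_of_sums:
  assumes "2 * L \<le> a"
    and S: "(\<lambda>s. of_real (sqrt (2 * real a - 4 * real L + 1) * hat_coeff a L s)
              * (- \<i> * of_real \<theta>) ^ (a + 1 + 2 * s)) sums S"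
  shows "F (int a - 1) (2 * int L - 1) \<theta> = S"
proof -
  from assms(1) have "L \<le> a"
    by linarith
  define K where "K = sqrt (2 * real a - 4 * real L + 1) * hat_coeff a L 0"
  define v where "v s = pochhammer ((real a + 2) / 2) s * pochhammer ((real a + 3) / 2) s
        / (pochhammer (real L + 3 / 2) s * pochhammer (real a + 3 / 2) s
           * pochhammer (real a + 2 - real L) s * fact s) * (- (\<theta>\<^sup>2 / 4)) ^ s" for s
  define w where "w = of_real K * (- \<i> * of_real \<theta>) ^ (a + 1)"
  have F: "F (int a - 1) (2 * int L - 1) \<theta> = w * of_real (\<Sum>s. v s)"
  proof -
    have params: "2 * real_of_int (int a - 1) - 2 * real_of_int (2 * int L - 1) + 1 = 2 * real a - 4 * real L + 1"
      "(real_of_int (int a - 1) + 3) / 2 = (real a + 2) / 2"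
      "(real_of_int (int a - 1) + 4) / 2 = (real a + 3) / 2"
      "(real_of_int (2 * int L - 1) + 4) / 2 = real L + 3 / 2"
      "real_of_int (int a - 1) + 5 / 2 = real a + 3 / 2"
      "real_of_int (int a - 1) + (5 - real_of_int (2 * int L - 1)) / 2 = real a + 2 - real L"
      by (simp_all add: field_simps)
    have nats: "nat ((2 * int L - 1 + 1) div 2) = L" "nat (2 * int L - 1 + 1) = 2 * L"
      "nat (int a - 1 + 1) = a" "nat (int a - 1 + 2) = a + 1" "nat (2 * int L - 1 + 2) = 2 * L + 1"
      using \<open>L \<le> a\<close> by linarith+
    have nats': "nat (2 * (int a - 1) + 3) = 2 * a + 1"
      by (simp add: nat_eq_iff)
    have "(3 - (2 * int L - 1)) div 2 = 2 - int L"
      by presburger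
    then have nats'': "nat (int a - 1 + (3 - (2 * int L - 1)) div 2) = a + 1 - L"
      using \<open>L \<le> a\<close> by simp
    have "(-1) ^ L * 2 ^ (2 * L) = ((-4) ^ L :: real)"
      by (simp add: power_mult flip: power_mult_distrib)
    then have const: "(-1) ^ L * 2 ^ (2 * L) * fact L * fact a * fact (a + 1)
        / (fact (2 * L + 1) * fact (2 * a + 1) * fact (a + 1 - L)) = hat_coeff a L 0"
      by (simp add: hat_coeff_def mult_ac)
    show ?thesis
      unfolding F_def hyp2F3_series v_def w_def K_def params nats nats' nats'' const
      by (simp only: mult.commute [of "hat_coeff a L 0"])
  qed
  have "of_real (sqrt (2 * real a - 4 * real L + 1) * hat_coeff a L s)
      * (- \<i> * of_real \<theta>) ^ (a + 1 + 2 * s) = w * of_real (v s)" for s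
  proof -
    have "(- \<i> * complex_of_real \<theta>) ^ (2 * s) = of_real ((- (\<theta>\<^sup>2)) ^ s)"
      by (simp add: power_mult power_mult_distrib)
    moreover have "(- (\<theta>\<^sup>2 / 4)) ^ s = (- (\<theta>\<^sup>2)) ^ s * (1 / 4) ^ s"
      by (simp flip: power_mult_distrib)
    ultimately show ?thesis
      unfolding w_def v_def K_def power_add [of _ "a + 1"] hat_coeff_hypergeometric [OF \<open>L \<le> a\<close>, of s]
      by (simp add: mult_ac)
  qed
  with S have wv: "(\<lambda>s. w * of_real (v s)) sums S"
    by simp
  show ?thesis
  proof (cases "\<theta> = 0")
    case True
    then have "w = 0"
      by (simp add: w_def)
    with wv have "(\<lambda>s. 0) sums S"
      by simp
    then have "S = 0"
      using sums_zero sums_unique2 by blast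
    with \<open>w = 0\<close> F show ?thesis
      by (simp only: mult_zero_left)
  next
    case False
    have "2 * real a - 4 * real L + 1 > 0"
      using assms(1) by linarith
    then have "K \<noteq> 0"
      by (simp add: K_def hat_coeff_def del: fact_Suc)
    with False have "w \<noteq> 0"
      by (simp add: w_def)
    then have "(\<lambda>s. complex_of_real (v s)) sums (S / w)"
      using sums_divide [OF wv, of w] by simp
    then have "summable v" "S / w = (\<Sum>s. of_real (v s))"
      by (auto simp: sums_iff summable_complex_of_real)
    then have "S / w = of_real (\<Sum>s. v s)"
      by (simp add: suminf_of_real)
    then show ?thesis
      using F \<open>w \<noteq> 0\<close> by (simp add: field_simps)
  qed
qed

section \<open>Surviving and vanishing moments\<close>

lemma pochhammer_neg_nat_fact:
  assumes "k \<le> n"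
  shows "pochhammer (- real n) k = (-1) ^ k * fact n / fact (n - k)"
proof -
  have "pochhammer (- real n) k = (-1) ^ k * real (n choose k) * fact k"
    using pochhammer_neg_nat [of n k] by (simp add: divide_simps)
  then show ?thesis
    using assms by (simp add: binomial_fact)
qed

text \<open>
  For odd \<open>i = 2l + 1\<close> the first power that survives both parity and vanishing moments is \<open>p = n + 2\<close>. At
  \<open>p = n + 2 + 2s\<close> the factors of the two products in the moment are \<open>-2 (s + 1 + m)\<close> and \<open>2 (n + 1 + s - m)\<close>,
  so that both become quotients of factorials.
\<close>

lemma d_coeff_moment_odd:
  assumes "2 * l + 1 \<le> n"
  shows "2 * (\<Sum>k\<le>n. d_coeff n (2 * l + 1) k / (real k + real (n + 2 + 2 * s) + 1)) / fact (n + 2 + 2 * s)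
     = sqrt (2 * real (n + 1) - 4 * real (l + 1) + 1) * hat_coeff (n + 1) (l + 1) s"
proof -
  let ?i = "2 * l + 1" and ?p = "n + 2 + 2 * s"
  have 1: "(\<Prod>m<l + 1. real n - real ?p - 2 * real m) = (-2) ^ (l + 1) * fact (s + l + 1) / fact s"
  proof -
    have "fact s * (\<Prod>m<L. real n - real ?p - 2 * real m) = (-2) ^ L * fact (s + L)" for L
    proof (induction L)
      case (Suc L)
      have "fact s * (\<Prod>m<Suc L. real n - real ?p - 2 * real m)
          = (fact s * (\<Prod>m<L. real n - real ?p - 2 * real m)) * (-2 * (real s + real L + 1))"
        by (simp add: algebra_simps)
      also have "\<dots> = (-2) ^ Suc L * fact (s + Suc L)"
        by (subst Suc.IH) (simp add: algebra_simps)
      finally show ?case .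
    qed simp
    from this [of "l + 1"] show ?thesis
      by (simp add: field_simps del: prod.lessThan_Suc fact_Suc)
  qed
  have 2: "(\<Prod>m<l. real n + real ?p - 2 * real m) = 2 ^ l * fact (n + 1 + s) / fact (n + 1 + s - l)"
  proof -
    have "L \<le> n + 1 + s \<Longrightarrow>
      fact (n + 1 + s - L) * (\<Prod>m<L. real n + real ?p - 2 * real m) = 2 ^ L * fact (n + 1 + s)" for L
    proof (induction L)
      case (Suc L)
      have "fact (n + 1 + s - L) = real (n + 1 + s - L) * fact (n + 1 + s - Suc L)"
        using Suc.prems by (subst fact_reduce) simp_all
      moreover have "real n + real ?p - 2 * real L = 2 * real (n + 1 + s - L)"
        using Suc.prems by (simp add: of_nat_diff)
      ultimately have "fact (n + 1 + s - Suc L) * (\<Prod>m<Suc L. real n + real ?p - 2 * real m)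
          = 2 * (fact (n + 1 + s - L) * (\<Prod>m<L. real n + real ?p - 2 * real m))"
        by (simp only: prod.lessThan_Suc mult_ac)
      also have "\<dots> = 2 ^ Suc L * fact (n + 1 + s)"
        using Suc by simp
      finally show ?case .
    qed simp
    from this [of l] show ?thesis
      using assms by (simp add: field_simps del: fact_Suc)
  qed
  have 3: "pochhammer (- real n) ?i = (-1) ^ ?i * fact n / fact (n - ?i)"
    using assms by (rule pochhammer_neg_nat_fact)
  have "?p - (n - ?i) = 2 * s + 2 * l + 3"
    using assms by linarith
  then have 4: "pochhammer (- real ?p) (n - ?i) = (-1) ^ (n - ?i) * fact ?p / fact (2 * s + 2 * l + 3)"
    using pochhammer_neg_nat_fact [of "n - ?i" ?p] by simp
  \<comment> \<open>The signs of \<open>(-n)\<^sub>i\<close>, \<open>(-p)\<^sub>n\<^sub>-\<^sub>i\<close> and the prefactor \<open>(-1) ^ n\<close> cancel.\<close>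
  have sign: "(-1) ^ n = (-1) ^ ?i * ((-1) ^ (n - ?i) :: real)"
    using assms by (simp only: power_add [symmetric] le_add_diff_inverse)
  have halves: "(?i + 1) div 2 = l + 1" "(?i - 1) div 2 = l"
    by simp_all
  have "(-4) ^ (l + 1) = 2 * ((-2) ^ (l + 1) * 2 ^ l :: real)"
    by (simp flip: power_mult_distrib)
  then have hc: "hat_coeff (n + 1) (l + 1) s = 2 * ((-2) ^ (l + 1) * 2 ^ l) * fact ?p * fact (s + l + 1) * fact (n + 1 + s)
     / (fact s * fact (n + 1 + s - l) * fact (2 * s + 2 * l + 3) * fact (n + ?p + 1))"
    by (simp add: hat_coeff_def algebra_simps numeral_3_eq_3 numeral_2_eq_2 del: power_Suc fact_Suc)
  have "sqrt (2 * real (n + 1) - 4 * real (l + 1) + 1) = sqrt (2 * real n - 2 * real ?i + 1)"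
    by simp
  \<comment> \<open>\<open>r\<close> is the square root, \<open>x\<close> and \<open>y\<close> come from the two products, and \<open>q\<close>, \<open>u\<close> are the remaining factorials.\<close>
  moreover have "2 * (((-1) ^ ?i * (-1) ^ (n - ?i)) * (r / ((-1) ^ ?i * fact n / fact (n - ?i)))
       * ((-1) ^ (n - ?i) * fact ?p / q / fact (n - ?i) * (x / fact s) * y)
       * (fact n * fact ?p / u)) / fact ?p = r * (2 * x * y * fact ?p / (fact s * q * u))"
    for r q x y u :: real
  proof -
    have "(-1) ^ ?i * (-1) ^ ?i = (1 :: real)" "(-1) ^ (n - ?i) * (-1) ^ (n - ?i) = (1 :: real)"
      by (simp_all flip: power_mult_distrib)
    then show ?thesis
      by (simp add: field_simps del: fact_Suc)
  qed
  ultimately show ?thesis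
    unfolding d_coeff_moment [OF assms] halves 1 2 3 4 sign hc
    by (simp add: mult_ac del: power_Suc fact_Suc)
qed

text \<open>
  For \<open>i = 0\<close> both products are empty and the surviving powers start at \<open>p = n + 1\<close>. This is the pattern of the
  odd case with \<open>n\<close> lowered by one and \<open>L = 0\<close>, which is why the two cases share \<^const>\<open>hat_coeff\<close>.
\<close>

lemma d_coeff_moment_0:
  "2 * (\<Sum>k\<le>n. d_coeff n 0 k / (real k + real (n + 1 + 2 * s) + 1)) / fact (n + 1 + 2 * s)
     = sqrt (2 * real n - 4 * real 0 + 1) * hat_coeff n 0 s"
proof -
  let ?p = "n + 1 + 2 * s"
  have 1: "pochhammer (- real ?p) n = (-1) ^ n * fact ?p / fact (2 * s + 1)"
    using pochhammer_neg_nat_fact [of n ?p] by (simp del: fact_Suc)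
  have 2: "fact (n + ?p + 1) = 2 * (real n + s + 1) * fact (2 * n + 1 + 2 * s)"
  proof -
    have "n + ?p + 1 = Suc (2 * n + 1 + 2 * s)"
      by simp
    then show ?thesis
      by (simp only: fact_Suc) (simp add: algebra_simps)
  qed
  have 3: "fact (n + 1 + s) = (real n + s + 1) * fact (n + s)"
    by (simp add: algebra_simps)
  have sign: "(-1) ^ n * (-1) ^ n = (1 :: real)"
    by (simp flip: power_mult_distrib)
  have nz: "real n + s + 1 \<noteq> 0"
    by linarith
  have "(\<Sum>k\<le>n. d_coeff n 0 k / (real k + real ?p + 1))
      = ((-1) ^ n * (-1) ^ n) * (sqrt (2 * real n + 1) * (fact ?p * fact ?p / (fact (2 * s + 1) * fact (n + ?p + 1))))"
    unfolding d_coeff_moment [OF le0]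
    using 1 by (simp del: fact_Suc)
  then have "2 * (\<Sum>k\<le>n. d_coeff n 0 k / (real k + real ?p + 1)) / fact ?p
      = sqrt (2 * real n + 1) * (2 * fact ?p / (fact (2 * s + 1) * fact (n + ?p + 1)))"
    unfolding sign by (simp del: fact_Suc)
  also have "2 * fact ?p / (fact (2 * s + 1) * fact (n + ?p + 1)) = hat_coeff n 0 s"
    unfolding hat_coeff_def 2 diff_zero 3
    using nz by (simp add: divide_simps del: fact_Suc)
  finally show ?thesis
    by simp
qed

text \<open>
  Orthogonality to low powers. For \<open>p < n - j\<close> the factor \<open>(-p)\<^sub>n\<^sub>-\<^sub>j\<close> vanishes; for \<open>n - j \<le> p \<le> n\<close> and odd
  \<open>j\<close> the parity condition makes \<open>n - p\<close> an even number \<open>2m < j\<close>, and the factor \<open>n - p - 2m\<close> of the first product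
  vanishes. For \<open>j = 0\<close> the only remaining power \<open>p = n\<close> has the wrong parity.
\<close>

lemma d_coeff_moment_eq_0:
  assumes "j \<le> n" "j = 0 \<or> odd j" "p \<le> n" "even (n - j + 1 + p)"
  shows "(\<Sum>k\<le>n. d_coeff n j k / (real k + real p + 1)) = 0"
proof (cases "p < n - j")
  case True
  then have "pochhammer (- real p) (n - j) = 0"
    by (rule pochhammer_of_nat_eq_0_lemma)
  then show ?thesis
    by (simp add: d_coeff_moment [OF assms(1)])
next
  case False
  have "odd j"
  proof (rule ccontr)
    assume "\<not> odd j"
    with False assms have "j = 0" "p = n"
      by auto
    with assms(4) show False by simp
  qed
  then obtain l where j: "j = 2 * l + 1"
    by (rule oddE)
  have "even (n - p)"
    using assms(1,3,4) \<open>odd j\<close> by simp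
  then obtain m where m: "n - p = 2 * m"
    by (rule evenE)
  then have "n = p + 2 * m"
    using assms(3) by simp
  with False assms(1) have "m < (j + 1) div 2" "real n - real p - 2 * real m = 0"
    by (simp_all add: j)
  then have "(\<Prod>m<(j + 1) div 2. real n - real p - 2 * real m) = 0"
    by (intro prod_zero) auto
  then show ?thesis
    by (simp add: d_coeff_moment [OF assms(1)])
qed

section \<open>The Fourier transforms\<close>

text \<open>
  Combines the moment expansion with the vanishing of the low moments. Here \<open>a + 1\<close> is the first surviving
  power, and \<open>vanish\<close> says that the powers strictly between \<open>n\<close> and \<open>a + 1\<close> have the wrong parity.
\<close>

lemma h_hat_eq_F:
  fixes n j a L :: nat and \<theta> :: real
  assumes "j \<le> n" "j = 0 \<or> odd j" "2 * L \<le> a" "n \<le> a" "even (n - j + a)"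
    and moment: "\<And>s. 2 * (\<Sum>k\<le>n. d_coeff n j k / (real k + real (a + 1 + 2 * s) + 1)) / fact (a + 1 + 2 * s)
       = sqrt (2 * real a - 4 * real L + 1) * hat_coeff a L s"
    and vanish: "\<And>p. n < p \<Longrightarrow> p \<le> a \<Longrightarrow> odd (n - j + 1 + p)"
  shows "h_hat n (n - j) \<theta> = F (int a - 1) (2 * int L - 1) \<theta>"
proof -
  define M where "M p = (\<Sum>k\<le>n. d_coeff n j k / (real k + real p + 1))" for p
  define f where "f p = (1 + (-1) ^ (n - j + 1 + p)) * (- \<i> * complex_of_real \<theta>) ^ p / fact p * of_real (M p)" for p
  have "f sums h_hat n (n - j) \<theta>"
    unfolding f_def M_def using assms(1,2) by (intro h_hat_sums_moments) (auto simp: h_poly_def)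
  moreover have "f p = 0" if "p \<notin> range (\<lambda>s. a + 1 + 2 * s)" for p
  proof (cases "even (n - j + 1 + p)")
    case True
    have "p \<le> a"
    proof (rule ccontr)
      assume "\<not> p \<le> a"
      moreover have "even (p - (a + 1))"
        using True assms(5) \<open>\<not> p \<le> a\<close> by presburger
      ultimately have "p = a + 1 + 2 * ((p - (a + 1)) div 2)"
        by simp
      with that show False by blast
    qed
    have "p \<le> n"
      using True vanish [of p] \<open>p \<le> a\<close> not_le by blast
    then have "M p = 0"
      unfolding M_def using assms(1,2) True by (intro d_coeff_moment_eq_0)
    then show ?thesis by (simp add: f_def)
  qed (simp add: f_def)
  moreover have "strict_mono (\<lambda>s. a + 1 + 2 * s)"
    by (simp add: strict_mono_def)
  ultimately have "(\<lambda>s. f (a + 1 + 2 * s)) sums h_hat n (n - j) \<theta>"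
    by (subst sums_mono_reindex)
  moreover have "f (a + 1 + 2 * s) = of_real (sqrt (2 * real a - 4 * real L + 1) * hat_coeff a L s)
      * (- \<i> * of_real \<theta>) ^ (a + 1 + 2 * s)" for s
  proof -
    have "even (n - j + 1 + (a + 1 + 2 * s))"
      using assms(5) by simp
    then have "(-1) ^ (n - j + 1 + (a + 1 + 2 * s)) = (1 :: complex)"
      by (simp only: minus_one_power_iff if_True)
    then have "f (a + 1 + 2 * s) = of_real (2 * M (a + 1 + 2 * s) / fact (a + 1 + 2 * s))
        * (- \<i> * of_real \<theta>) ^ (a + 1 + 2 * s)"
      unfolding f_def
      by (simp only: of_real_divide of_real_mult of_real_fact of_real_numeral one_add_one
            times_divide_eq_left times_divide_eq_right mult_ac)
    then show ?thesis
      by (simp only: M_def moment)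
  qed
  ultimately show ?thesis
    using F_eq_of_sums [OF assms(3)] by simp
qed

lemma h_hat_odd:
  assumes "j \<le> n" "odd j"
  shows "h_hat n (n - j) \<theta> = F (int n) (int j) \<theta>"
proof -
  obtain l where j: "j = 2 * l + 1"
    using assms(2) by (rule oddE)
  \<comment> \<open>The power \<open>n + 1\<close> has the wrong parity, so the series starts at \<open>n + 2\<close>, that is, \<open>a = n + 1\<close>.\<close>
  have "h_hat n (n - j) \<theta> = F (int (n + 1) - 1) (2 * int (l + 1) - 1) \<theta>"
  proof (rule h_hat_eq_F)
    show "even (n - j + (n + 1))" "\<And>p. n < p \<Longrightarrow> p \<le> n + 1 \<Longrightarrow> odd (n - j + 1 + p)"
      using assms by (auto simp: le_Suc_eq)
    show "2 * (\<Sum>k\<le>n. d_coeff n j k / (real k + real (n + 1 + 1 + 2 * s) + 1)) / fact (n + 1 + 1 + 2 * s)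
       = sqrt (2 * real (n + 1) - 4 * real (l + 1) + 1) * hat_coeff (n + 1) (l + 1) s" for s
      using d_coeff_moment_odd [of l n s] assms(1)
      by (simp only: j add.assoc one_add_one)
  qed (use assms j in auto)
  then show ?thesis
    by (simp add: j add_ac)
qed

lemma h_hat_0: "h_hat n n \<theta> = F (int n - 1) (- 1) \<theta>"
proof -
  have "h_hat n (n - 0) \<theta> = F (int n - 1) (2 * int 0 - 1) \<theta>"
    by (rule h_hat_eq_F) (use d_coeff_moment_0 in auto)
  then show ?thesis by simp
qed

text \<open>
  By definition the polynomial for even index \<open>j\<close> and \<open>n\<close> is the one for the odd index \<open>j - 1\<close> and \<open>n - 1\<close>. The
  lower index \<open>n - j = (n - 1) - (j - 1)\<close> is the same, hence so is the reflection sign.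
\<close>

lemma h_even_index:
  assumes "j \<le> n" "even j" "2 \<le> j"
  shows "h n (n - j) = h (n - 1) (n - j)"
proof -
  have "h_poly n j = h_poly (n - 1) (j - 1)"
    using assms by (auto simp: h_poly_def fun_eq_iff)
  moreover have "n - (n - j) = j" "n - 1 - (n - j) = j - 1"
    using assms by linarith+
  ultimately show ?thesis
    by (simp add: h_def fun_eq_iff)
qed

theorem theorem15:
  fixes n j :: nat and \<theta> :: real
  assumes "j \<le> n"
  shows "(odd j \<longrightarrow> h_hat n (n - j) \<theta> = F (int n) (int j) \<theta>)
       \<and> (even j \<longrightarrow> h_hat n (n - j) \<theta> = F (int n - 1) (int j - 1) \<theta>)
       \<and> (even j \<and> 2 \<le> j \<longrightarrow> h_hat n (n - j) \<theta> = h_hat (n - 1) (n - j) \<theta>)"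
proof (intro conjI impI)
  assume "odd j"
  with assms show "h_hat n (n - j) \<theta> = F (int n) (int j) \<theta>"
    by (rule h_hat_odd)
next
  show lower: "h_hat n (n - j) \<theta> = h_hat (n - 1) (n - j) \<theta>" if "even j \<and> 2 \<le> j"
    using h_even_index [of j n] assms that by (simp only: h_hat_def)
  assume "even j"
  show "h_hat n (n - j) \<theta> = F (int n - 1) (int j - 1) \<theta>"
  proof (cases "j = 0")
    case True
    then show ?thesis by (simp add: h_hat_0)
  next
    case False
    with \<open>even j\<close> have "2 \<le> j" "odd (j - 1)"
      by (auto elim!: evenE)
    moreover have "n - 1 - (j - 1) = n - j"
      using False by simp
    ultimately show ?thesis
      using lower h_hat_odd [of "j - 1" "n - 1" \<theta>] \<open>even j\<close> assms by (simp add: of_nat_diff)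
  qed
qed

end
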